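(* Let $s>2$ be an integer, let $p_0,p_1,\dots,p_{s-1}$ be positive real numbers with $p_0+p_1+\dots+p_{s-1}=1$, and let $u\in\{0,1,\dots,s-1\}$. Then the set $\mathbb S_{(P_s,u)}\subset[0,1]$ is a perfect (closed without isolated points) and nowhere dense set of zero Lebesgue measure.
   Context: Let $s>2$ be an integer, $A=\{0,1,\dots,s-1\}$, $A_0=\{1,2,\dots,s-1\}$, and $P=\{p_0,\dots,p_{s-1}\}$ a fixed tuple of positive reals with sum $1$. Put $\beta_0=0$ and $\beta_k=\sum_{i=0}^{k-1}p_i$ for $k\in A_0$. For a sequence $(a_n)_{n\ge1}$ of elements of $A$, write $$\Delta^{P}_{a_1a_2\ldots a_n\ldots}=\beta_{a_1}+\sum_{n=2}^{\infty}\Big(\beta_{a_n}\prod_{j=1}^{n-1}p_{a_j}\Big)\in[0,1];$$ this is called the P-representation of the number. For fixed $u\in A$, the set $\mathbb S_{(P_s,u)}$ is $$\mathbb S_{(P_s,u)}=\Big\{x: x=\Delta^{P}_{\underbrace{u\ldots u}_{\alpha_1-1}\alpha_1\underbrace{u\ldots u}_{\alpha_2-1}\alpha_2\ldots\underbrace{u\ldots u}_{\alpha_n-1}\alpha_n\ldots},\ \alpha_n\in A_0\setminus\{u\}\text{ for all }n\ge1\Big\},$$ i.e. the digit sequence is the infinite concatenation of blocks, the $n$-th block consisting of $\alpha_n-1$ copies of the digit $u$ followed by the digit $\alpha_n$.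
   Formalization: The absence of isolated points is not claimed for s = 3 with u ∈ {1,2}: there A_0∖{u} has one element, the set is a single point, and that point is isolated; closedness, nowhere density and measure zero are still proved in that case. *)

theory Defs
  imports "HOL-Analysis.Analysis" "HOL-Library.Stream"
begin

definition \<beta> :: "(nat \<Rightarrow> real) \<Rightarrow> nat \<Rightarrow> real" where
  "\<beta> p k = (\<Sum>i<k. p i)"

text \<open>
  Streams are indexed from 0, so \<open>a !! n\<close> is the digit $a_{n+1}$. The term for \<open>n = 0\<close> has an empty
  product and is the leading summand $\beta_{a_1}$.
\<close>

definition P_rep :: "(nat \<Rightarrow> real) \<Rightarrow> nat stream \<Rightarrow> real" where
  "P_rep p a = (\<Sum>n. \<beta> p (a !! n) * (\<Prod>j<n. p (a !! j)))"

definition block :: "nat \<Rightarrow> nat \<Rightarrow> nat list" where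
  "block u k = replicate (k - 1) u @ [k]"

definition S_set :: "nat \<Rightarrow> (nat \<Rightarrow> real) \<Rightarrow> nat \<Rightarrow> real set" where
  "S_set s p u = {P_rep p (flat (smap (block u) \<alpha>)) |\<alpha>. \<alpha> \<in> streams ({1..<s} - {u})}"

definition perfect_set :: "'a::topological_space set \<Rightarrow> bool" where
  "perfect_set X \<longleftrightarrow> closed X \<and> \<not> (\<exists>x. x isolated_in X)"

definition nowhere_dense :: "'a::topological_space set \<Rightarrow> bool" where
  "nowhere_dense X \<longleftrightarrow> interior (closure X) = {}"

end

theory Submission
  imports Defs
begin

text \<open>
  Prefixing a digit \<open>d\<close> to a digit sequence acts on the represented number by the increasing affine
  map \<open>\<phi> d x = \<beta> p d + p d * x\<close> of \<open>[0, 1]\<close>, so prefixing the block \<open>u\<dots>uk\<close> acts by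
  \<open>\<psi> k = (\<phi> u)\<^sup>k\<^sup>-\<^sup>1 \<circ> \<phi> k\<close>, an affine map of slope \<open>p u ^ (k - 1) * p k \<le> p k \<le> 1 - p 0\<close>. Hence the
  set \<open>S\<close> in question is self-similar: \<open>S = (\<Union>k\<in>D. \<psi> k ` S)\<close> with \<open>D = {1..<s} - {u}\<close>. Everything
  follows from this equation and from the fact that the \<open>\<psi> k\<close> contract uniformly.

  \<^item> \<^emph>\<open>Closedness.\<close> A set \<open>K \<subseteq> [0, 1]\<close> with \<open>K \<subseteq> (\<Union>k\<in>D. \<psi> k ` K)\<close> is contained in \<open>S\<close>, because
    unfolding the inclusion forever at \<open>x \<in> K\<close> produces a block sequence whose value is \<open>x\<close>
    (\<open>self_covering_subset\<close>). The closure of \<open>S\<close> is such a set, as \<open>D\<close> is finite.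
  \<^item> \<^emph>\<open>Measure.\<close> The measure of \<open>S\<close> is at most the sum of the slopes times itself, and the slopes
    add up to at most \<open>1 - p 0 < 1\<close>. Nowhere density follows, as \<open>S\<close> is closed and null.
  \<^item> \<^emph>\<open>No isolated points.\<close> If \<open>S\<close> has two points, then every point of \<open>S\<close> lies in sets
    \<open>\<psi> k\<^sub>1 (\<dots> (\<psi> k\<^sub>n ` S))\<close>, which have two points and arbitrarily small diameter. If \<open>D\<close> has
    elements \<open>k < l\<close>, then \<open>S\<close> has two points: otherwise its only point would be fixed by \<open>\<psi> k\<close> and
    \<open>\<psi> l\<close>. Being a value of \<open>\<psi> k\<close> with \<open>1 \<le> k < s - 1\<close>, it would lie in the open unit interval,
    whose images under \<open>\<psi> k\<close> and \<open>\<psi> l\<close> are disjoint because the blocks differ at position \<open>k\<close>.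
\<close>

section \<open>Digit maps and the representation\<close>

text \<open>A positive probability vector on the digits \<open>0, \<dots>, s - 1\<close>, with a distinguished digit \<open>u\<close>.\<close>

locale digit_weights =
  fixes s u :: nat and p :: "nat \<Rightarrow> real"
  assumes p_pos: "i < s \<Longrightarrow> p i > 0"
    and p_sum: "(\<Sum>i<s. p i) = 1"
    and u_less: "u < s"
begin

text \<open>The map that prefixing the digit \<open>d\<close> induces on represented numbers.\<close>

definition \<phi> :: "nat \<Rightarrow> real \<Rightarrow> real" where
  "\<phi> d x = \<beta> p d + p d * x"

lemma p_nonneg: "i < s \<Longrightarrow> 0 \<le> p i"
  by (simp add: less_imp_le p_pos)

lemma beta_nonneg: "d \<le> s \<Longrightarrow> 0 \<le> \<beta> p d"
  unfolding \<beta>_def by (intro sum_nonneg) (auto intro: p_nonneg)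

lemma beta_Suc: "\<beta> p (Suc d) = \<beta> p d + p d"
  by (simp add: \<beta>_def)

lemma beta_mono: "d \<le> e \<Longrightarrow> e \<le> s \<Longrightarrow> \<beta> p d \<le> \<beta> p e"
  unfolding \<beta>_def by (intro sum_mono2) (auto intro: p_nonneg)

lemma beta_s: "\<beta> p s = 1"
  by (simp add: \<beta>_def p_sum)

lemma beta_Suc_le_1: "d < s \<Longrightarrow> \<beta> p d + p d \<le> 1"
  using beta_mono[of "Suc d" s] by (simp add: beta_Suc beta_s)

lemma p_le_1: "d < s \<Longrightarrow> p d \<le> 1"
  using beta_Suc_le_1[of d] beta_nonneg[of d] by simp

lemma beta_pos:
  assumes "1 \<le> d" "d < s" shows "0 < \<beta> p d"
  using beta_mono[of 1 d] assms p_pos[of 0] by (simp add: \<beta>_def)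

lemma phi_pos:
  assumes "d < s" "0 < x" shows "0 < \<phi> d x"
  using assms p_pos[of d] beta_nonneg[of d] by (simp add: \<phi>_def add_nonneg_pos)

lemma phi_less_beta_Suc:
  assumes "d < s" "x < 1" shows "\<phi> d x < \<beta> p (Suc d)"
  using assms p_pos[of d] by (simp add: \<phi>_def beta_Suc)

lemma phi_less_1:
  assumes "d < s" "x < 1" shows "\<phi> d x < 1"
  using phi_less_beta_Suc[OF assms] beta_mono[of "Suc d" s] assms(1) by (simp add: beta_s)

text \<open>Distinct digits map the open unit interval to disjoint cylinders.\<close>

lemma phi_neq:
  assumes "d < s" "e < s" "d \<noteq> e" "0 < x" "x < 1" "0 < y" "y < 1"
  shows "\<phi> d x \<noteq> \<phi> e y"
proof -
  have less: "\<phi> d x < \<phi> e y" if "d < e" "e < s" "0 < y" "x < 1" for d e x y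
  proof -
    have "\<phi> d x < \<beta> p (Suc d)"
      using that by (intro phi_less_beta_Suc) auto
    also have "\<dots> \<le> \<beta> p e"
      using that by (intro beta_mono) auto
    also have "\<dots> < \<phi> e y"
      using that p_pos[of e] by (simp add: \<phi>_def)
    finally show ?thesis .
  qed
  show ?thesis
    using less[of d e y x] less[of e d x y] assms by (cases "d < e") auto
qed

lemma P_rep_term_nonneg:
  assumes "a \<in> streams {..<s}"
  shows "0 \<le> \<beta> p (a !! n) * (\<Prod>j<n. p (a !! j))"
  using assms
  by (intro mult_nonneg_nonneg prod_nonneg beta_nonneg)
     (auto simp: streams_iff_snth intro: p_nonneg less_imp_le)

text \<open>
  As \<open>\<beta> p d \<le> 1 - p d\<close>, the partial sums are dominated by a telescoping sum: they are at most
  one minus the length of the cylinder of the first \<open>N\<close> digits.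
\<close>

lemma P_rep_partial_sum_le:
  assumes "a \<in> streams {..<s}"
  shows "(\<Sum>n<N. \<beta> p (a !! n) * (\<Prod>j<n. p (a !! j))) \<le> 1 - (\<Prod>j<N. p (a !! j))"
proof (induction N)
  case (Suc N)
  have a: "a !! n < s" for n
    using assms by (auto simp: streams_iff_snth)
  define c where "c = (\<Prod>j<N. p (a !! j))"
  have "0 \<le> c"
    unfolding c_def by (intro prod_nonneg) (auto intro: p_nonneg a)
  hence "(\<beta> p (a !! N) + p (a !! N)) * c \<le> 1 * c"
    by (intro mult_right_mono beta_Suc_le_1 a)
  thus ?case
    using Suc by (simp add: c_def[symmetric] algebra_simps)
qed simp

lemma P_rep_partial_sum_le_1:
  assumes "a \<in> streams {..<s}"
  shows "(\<Sum>n<N. \<beta> p (a !! n) * (\<Prod>j<n. p (a !! j))) \<le> 1"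
proof -
  have "0 \<le> (\<Prod>j<N. p (a !! j))"
    using assms by (intro prod_nonneg) (auto simp: streams_iff_snth intro: p_nonneg)
  thus ?thesis
    using P_rep_partial_sum_le[OF assms, of N] by linarith
qed

lemma P_rep_summable:
  assumes "a \<in> streams {..<s}"
  shows "summable (\<lambda>n. \<beta> p (a !! n) * (\<Prod>j<n. p (a !! j)))"
  using P_rep_term_nonneg[OF assms] P_rep_partial_sum_le_1[OF assms]
  by (rule summableI_nonneg_bounded)

lemma P_rep_in_Icc:
  assumes "a \<in> streams {..<s}"
  shows "P_rep p a \<in> {0..1}"
  using suminf_nonneg[OF P_rep_summable P_rep_term_nonneg, OF assms assms]
    suminf_le_const[OF P_rep_summable P_rep_partial_sum_le_1, OF assms assms]
  by (simp add: P_rep_def)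

lemma P_rep_SCons:
  assumes "d < s" "a \<in> streams {..<s}"
  shows "P_rep p (d ## a) = \<phi> d (P_rep p a)"
proof -
  define f where "f n = \<beta> p ((d ## a) !! n) * (\<Prod>j<n. p ((d ## a) !! j))" for n
  have shift: "f (Suc n) = p d * (\<beta> p (a !! n) * (\<Prod>j<n. p (a !! j)))" for n
    unfolding f_def by (simp add: prod.lessThan_Suc_shift del: prod.lessThan_Suc)
  have "summable f"
    using assms unfolding f_def by (intro P_rep_summable) (simp add: streams_Stream)
  hence "suminf f = (\<Sum>n. f (Suc n)) + f 0"
    by (simp add: suminf_split_head)
  also have "(\<Sum>n. f (Suc n)) = p d * P_rep p a"
    unfolding shift P_rep_def using assms(2) by (intro suminf_mult P_rep_summable)
  finally show ?thesis
    by (simp add: P_rep_def \<phi>_def f_def)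
qed


section \<open>Block maps and self-similarity\<close>

text \<open>The admissible block labels.\<close>

definition D :: "nat set" where
  "D = {1..<s} - {u}"

text \<open>The map that prefixing the block with label \<open>k\<close> induces on represented numbers.\<close>

definition \<psi> :: "nat \<Rightarrow> real \<Rightarrow> real" where
  "\<psi> k x = (\<phi> u ^^ (k - 1)) (\<phi> k x)"

text \<open>The slope of \<open>\<psi> k\<close>.\<close>

definition \<rho> :: "nat \<Rightarrow> real" where
  "\<rho> k = p u ^ (k - 1) * p k"

text \<open>The set \<open>S_set s p u\<close>, as the image of the streams of admissible labels.\<close>

definition S :: "real set" where
  "S = (\<lambda>\<alpha>. P_rep p (flat (smap (block u) \<alpha>))) ` streams D"

lemma S_set_eq: "S_set s p u = S"
  by (auto simp: S_set_def S_def D_def)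

lemma D_less: "k \<in> D \<Longrightarrow> k < s"
  and D_ge_1: "k \<in> D \<Longrightarrow> 1 \<le> k"
  and D_neq_u: "k \<in> D \<Longrightarrow> k \<noteq> u"
  and finite_D: "finite D"
  by (auto simp: D_def)

lemma phi_funpow_diff: "(\<phi> d ^^ n) x - (\<phi> d ^^ n) y = p d ^ n * (x - y)"
proof (induction n)
  case (Suc n)
  have "\<phi> d v - \<phi> d w = p d * (v - w)" for v w
    by (simp add: \<phi>_def algebra_simps)
  thus ?case using Suc by simp
qed simp

lemma psi_diff: "\<psi> k x - \<psi> k y = \<rho> k * (x - y)"
  unfolding \<psi>_def \<rho>_def phi_funpow_diff by (simp add: \<phi>_def algebra_simps)

lemma psi_affine: "\<psi> k x = \<rho> k * x + \<psi> k 0"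
  using psi_diff[of k x 0] by simp

lemma rho_pos: "k \<in> D \<Longrightarrow> 0 < \<rho> k"
  by (simp add: \<rho>_def p_pos u_less D_less)

lemma rho_le: "k \<in> D \<Longrightarrow> \<rho> k \<le> p k"
  unfolding \<rho>_def using p_pos[OF u_less] p_le_1[OF u_less] p_pos[OF D_less, of k]
  by (simp add: mult_left_le_one_le power_le_one)

lemma sum_rho_le: "(\<Sum>k\<in>D. \<rho> k) \<le> 1 - p 0"
proof -
  have "(\<Sum>k\<in>D. \<rho> k) \<le> (\<Sum>k\<in>D. p k)"
    by (intro sum_mono rho_le)
  also have "\<dots> \<le> (\<Sum>k\<in>{..<s} - {0}. p k)"
    by (intro sum_mono2) (auto simp: D_def intro: p_nonneg)
  also have "\<dots> = 1 - p 0"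
    using u_less p_sum by (subst sum_diff1) auto
  finally show ?thesis .
qed

lemma rho_le_1_minus:
  assumes "k \<in> D" shows "\<rho> k \<le> 1 - p 0"
proof -
  have "\<rho> k \<le> (\<Sum>k\<in>D. \<rho> k)"
    using assms rho_pos by (intro member_le_sum) (auto simp: finite_D intro: less_imp_le)
  thus ?thesis using sum_rho_le by linarith
qed

lemma p0_pos: "0 < p 0"
  using u_less by (intro p_pos) simp

lemma contraction_nonneg: "0 \<le> 1 - p 0"
  using p_le_1[of 0] u_less by simp

lemma psi_contract:
  assumes "k \<in> D" shows "\<bar>\<psi> k x - \<psi> k y\<bar> \<le> (1 - p 0) * \<bar>x - y\<bar>"
  using rho_le_1_minus[OF assms] rho_pos[OF assms]
  by (auto simp: psi_diff abs_mult intro: mult_right_mono)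

lemma psi_inj: "k \<in> D \<Longrightarrow> \<psi> k x = \<psi> k y \<Longrightarrow> x = y"
  using psi_diff[of k x y] rho_pos[of k] by simp

lemma block_stream_in_streams:
  assumes "\<alpha> \<in> streams D"
  shows "flat (smap (block u) \<alpha>) \<in> streams {..<s}"
proof -
  have "\<forall>xs\<in>sset (smap (block u) \<alpha>). xs \<noteq> []"
    by (auto simp: block_def stream.set_map)
  moreover have "set (block u k) \<subseteq> {..<s}" if "k \<in> D" for k
    using that u_less by (auto simp: block_def D_less)
  ultimately show ?thesis
    using assms unfolding streams_iff_sset by (auto simp: stream.set_map)
qed

lemma S_subset: "S \<subseteq> {0..1}"
  unfolding S_def using P_rep_in_Icc block_stream_in_streams by blast

lemma P_rep_replicate:
  assumes "d < s" "a \<in> streams {..<s}"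
  shows "P_rep p (replicate n d @- a) = (\<phi> d ^^ n) (P_rep p a)"
proof (induction n)
  case (Suc n)
  have "replicate n d @- a \<in> streams {..<s}"
    using assms by (auto simp: streams_iff_sset)
  thus ?case using Suc assms by (simp add: P_rep_SCons)
qed simp

lemma P_rep_block:
  assumes "k \<in> D" "\<alpha> \<in> streams D"
  shows "P_rep p (flat (smap (block u) (k ## \<alpha>))) = \<psi> k (P_rep p (flat (smap (block u) \<alpha>)))"
proof -
  let ?a = "flat (smap (block u) \<alpha>)"
  have a: "?a \<in> streams {..<s}"
    by (rule block_stream_in_streams) fact
  have "flat (smap (block u) (k ## \<alpha>)) = replicate (k - 1) u @- k ## ?a"
    by (simp add: block_def)
  moreover have "k ## ?a \<in> streams {..<s}"
    using a assms D_less by (simp add: streams_Stream)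
  ultimately show ?thesis
    using a assms by (simp add: \<psi>_def P_rep_replicate P_rep_SCons D_less u_less)
qed

lemma S_psi: "k \<in> D \<Longrightarrow> x \<in> S \<Longrightarrow> \<psi> k x \<in> S"
  unfolding S_def by (auto simp: P_rep_block[symmetric] streams_Stream simp del: stream.map)

lemma S_cases:
  assumes "x \<in> S"
  obtains k y where "k \<in> D" "y \<in> S" "x = \<psi> k y"
proof -
  obtain \<alpha> where \<alpha>: "\<alpha> \<in> streams D" "x = P_rep p (flat (smap (block u) \<alpha>))"
    using assms by (auto simp: S_def)
  have in_D: "shd \<alpha> \<in> D" "stl \<alpha> \<in> streams D"
    using \<alpha>(1) by (auto elim: streams.cases)
  have "x = \<psi> (shd \<alpha>) (P_rep p (flat (smap (block u) (stl \<alpha>))))"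
    using P_rep_block[OF in_D] \<alpha>(2) by simp
  thus ?thesis
    using that in_D by (auto simp: S_def)
qed


section \<open>Closedness\<close>

text \<open>
  The set \<open>S\<close> is the largest subset of \<open>[0, 1]\<close> that is covered by its images under the block maps.
\<close>

lemma self_covering_subset:
  assumes "K \<subseteq> {0..1}" and cover: "K \<subseteq> (\<Union>k\<in>D. \<psi> k ` K)"
  shows "K \<subseteq> S"
proof -
  have "\<forall>x\<in>K. \<exists>k y. k \<in> D \<and> y \<in> K \<and> x = \<psi> k y"
    using cover by blast
  then obtain lab nxt where step: "\<And>x. x \<in> K \<Longrightarrow> lab x \<in> D \<and> nxt x \<in> K \<and> x = \<psi> (lab x) (nxt x)"
    by metis
  define \<alpha> where "\<alpha> x = smap lab (siterate nxt x)" for x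
  have \<alpha>_unfold: "\<alpha> x = lab x ## \<alpha> (nxt x)" for x
    unfolding \<alpha>_def by (subst siterate.ctr) simp
  have iter: "(nxt ^^ n) x \<in> K" if "x \<in> K" for n x
    using that step by (induction n) auto
  hence \<alpha>_in: "\<alpha> x \<in> streams D" if "x \<in> K" for x
    using that step by (auto simp: streams_iff_snth \<alpha>_def)
  define g where "g x = P_rep p (flat (smap (block u) (\<alpha> x)))" for x
  have g_step: "g x = \<psi> (lab x) (g (nxt x))" if "x \<in> K" for x
    using that step \<alpha>_in by (simp add: g_def \<alpha>_unfold[of x] P_rep_block del: stream.map)
  have close: "\<bar>x - g x\<bar> \<le> (1 - p 0) ^ n" if "x \<in> K" for x n
    using that
  proof (induction n arbitrary: x)
    case 0
    have "g x \<in> {0..1}"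
      unfolding g_def using 0 by (intro P_rep_in_Icc block_stream_in_streams \<alpha>_in)
    thus ?case using 0 assms(1) by (auto simp: abs_le_iff subset_iff)
  next
    case (Suc n)
    have "\<bar>x - g x\<bar> = \<bar>\<psi> (lab x) (nxt x) - \<psi> (lab x) (g (nxt x))\<bar>"
      using step[OF Suc.prems] g_step[OF Suc.prems] by simp
    also have "\<dots> \<le> (1 - p 0) * \<bar>nxt x - g (nxt x)\<bar>"
      using step[OF Suc.prems] by (intro psi_contract) simp
    also have "\<dots> \<le> (1 - p 0) * (1 - p 0) ^ n"
      using step[OF Suc.prems] by (intro mult_left_mono Suc.IH contraction_nonneg) simp
    finally show ?case by simp
  qed
  have lim: "(\<lambda>n. (1 - p 0) ^ n) \<longlonglongrightarrow> 0"
    using contraction_nonneg p0_pos by (intro LIMSEQ_realpow_zero) auto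
  have "x = g x" if "x \<in> K" for x
  proof -
    have "\<bar>x - g x\<bar> \<le> 0"
      using close[OF that] by (intro LIMSEQ_le_const[OF lim]) auto
    thus ?thesis by simp
  qed
  thus ?thesis
    using \<alpha>_in by (force simp: S_def g_def)
qed

lemma closed_S: "closed S"
proof -
  have sub: "closure S \<subseteq> {0..1}"
    by (intro closure_minimal S_subset) simp
  have "compact (closure S)"
    using sub bounded_subset[OF bounded_closed_interval]
    by (auto simp: compact_eq_bounded_closed)
  moreover have "continuous_on X (\<psi> k)" for X k
    by (subst psi_affine[abs_def]) (intro continuous_intros)
  ultimately have "closed (\<Union>k\<in>D. \<psi> k ` closure S)"
    by (intro closed_UN finite_D ballI compact_imp_closed compact_continuous_image)
  moreover have "S \<subseteq> (\<Union>k\<in>D. \<psi> k ` closure S)"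
    using closure_subset by (blast elim: S_cases)
  ultimately have "closure S \<subseteq> (\<Union>k\<in>D. \<psi> k ` closure S)"
    by (rule closure_minimal[rotated])
  from self_covering_subset[OF sub this] show ?thesis
    by (simp add: closure_subset_eq)
qed


section \<open>Measure\<close>

lemma null_S: "S \<in> null_sets lebesgue"
proof -
  have meas: "S \<in> lmeasurable"
    using closed_S bounded_subset[OF bounded_closed_interval S_subset]
    by (intro lmeasurable_compact) (simp add: compact_eq_bounded_closed)
  have image: "\<psi> k ` S = (\<lambda>x. \<rho> k *\<^sub>R x + \<psi> k 0) ` S" for k
    by (intro image_cong refl) (simp add: psi_affine[symmetric])
  have measure_image: "measure lebesgue (\<psi> k ` S) = \<rho> k * measure lebesgue S" if "k \<in> D" for k
    using rho_pos[OF that] measure_lebesgue_affine[of "\<rho> k" "\<psi> k 0" S] by (simp add: image)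
  have "closed (\<psi> k ` S)" for k
    unfolding image
    using closed_translation[OF closed_scaling[OF closed_S, of "\<rho> k"], of "\<psi> k 0"]
    by (simp add: image_image add.commute)
  hence sets_image: "\<psi> k ` S \<in> sets lebesgue" for k
    by simp
  have "S = (\<Union>k\<in>D. \<psi> k ` S)"
    using S_psi by (blast elim: S_cases)
  hence "measure lebesgue S \<le> (\<Sum>k\<in>D. measure lebesgue (\<psi> k ` S))"
    using measure_UNION_le[of D "\<lambda>k. \<psi> k ` S" lebesgue, OF finite_D sets_image] by simp
  also have "\<dots> = (\<Sum>k\<in>D. \<rho> k) * measure lebesgue S"
    by (simp add: measure_image sum_distrib_right)
  also have "\<dots> \<le> (1 - p 0) * measure lebesgue S"
    by (intro mult_right_mono sum_rho_le) simp
  finally have "p 0 * measure lebesgue S \<le> 0"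
    by (simp add: algebra_simps)
  hence "measure lebesgue S = 0"
    using p0_pos by (simp add: mult_le_0_iff order_antisym)
  thus ?thesis
    using meas by (simp add: negligible_iff_measure negligible_iff_null_sets[symmetric])
qed

lemma nowhere_dense_S: "nowhere_dense S"
proof -
  have "negligible (interior S)"
    using null_S interior_subset by (metis negligible_iff_null_sets negligible_subset)
  hence "interior S = {}"
    using open_not_negligible[OF open_interior] by blast
  thus ?thesis
    using closed_S by (simp add: nowhere_dense_def closure_closed)
qed


section \<open>Absence of isolated points\<close>

lemma phi_funpow_pos: "d < s \<Longrightarrow> 0 < x \<Longrightarrow> 0 < (\<phi> d ^^ n) x"
  by (induction n) (auto intro: phi_pos)

lemma phi_funpow_less_1: "d < s \<Longrightarrow> x < 1 \<Longrightarrow> (\<phi> d ^^ n) x < 1"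
  by (induction n) (auto intro: phi_less_1)

lemma psi_pos:
  assumes "k \<in> D" "0 \<le> x" shows "0 < \<psi> k x"
proof -
  have "0 < \<phi> k x"
    using assms beta_pos[OF D_ge_1 D_less, of k] p_pos[OF D_less, of k]
    by (simp add: \<phi>_def add_pos_nonneg)
  thus ?thesis by (simp add: \<psi>_def phi_funpow_pos u_less)
qed

lemma psi_less_1:
  assumes "k \<in> D" "Suc k < s" "x \<le> 1" shows "\<psi> k x < 1"
proof -
  have "\<phi> k x \<le> \<beta> p (Suc k)"
    using assms p_pos[of k] by (simp add: \<phi>_def beta_Suc)
  also have "\<dots> < \<beta> p (Suc (Suc k))"
    using assms(2) p_pos[of "Suc k"] by (simp add: beta_Suc[of "Suc k"])
  also have "\<dots> \<le> 1"
    using assms(2) beta_mono[of "Suc (Suc k)" s] by (simp add: beta_s)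
  finally show ?thesis by (simp add: \<psi>_def phi_funpow_less_1 u_less)
qed

text \<open>
  For \<open>k < l\<close> the blocks of \<open>k\<close> and \<open>l\<close> share a prefix of \<open>k - 1\<close> digits \<open>u\<close>, after which the first
  continues with \<open>k \<noteq> u\<close> and the second with \<open>u\<close>.
\<close>

lemma psi_neq:
  assumes "k \<in> D" "l \<in> D" "k < l" "0 < x" "x < 1"
  shows "\<psi> k x \<noteq> \<psi> l x"
proof
  define y where "y = (\<phi> u ^^ (l - k - 1)) (\<phi> l x)"
  have split: "l - 1 = (k - 1) + Suc (l - k - 1)"
    using assms D_ge_1[of k] by simp
  assume "\<psi> k x = \<psi> l x"
  hence "(\<phi> u ^^ (k - 1)) (\<phi> k x) = (\<phi> u ^^ (k - 1)) (\<phi> u y)"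
    unfolding \<psi>_def y_def split by (subst (asm) funpow_add) simp
  hence "\<phi> k x = \<phi> u y"
    using phi_funpow_diff[where d = u and n = "k - 1" and x = "\<phi> k x" and y = "\<phi> u y"]
      p_pos[OF u_less] by simp
  moreover have "0 < y" "y < 1"
    unfolding y_def using assms
    by (auto intro!: phi_funpow_pos phi_funpow_less_1 phi_pos phi_less_1 u_less D_less)
  ultimately show False
    using phi_neq[of k u x y] assms D_less D_neq_u u_less by blast
qed

lemma S_nonempty:
  assumes "k \<in> D" shows "S \<noteq> {}"
proof -
  have "sconst k \<in> streams D"
    using assms by (simp add: streams_iff_snth)
  thus ?thesis by (auto simp: S_def)
qed

lemma S_other_point:
  assumes "k \<in> D" "l \<in> D" "k < l"
  shows "\<exists>y\<in>S. y \<noteq> x"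
proof (rule ccontr)
  assume "\<not> ?thesis"
  hence S: "S = {x}"
    using S_nonempty[OF assms(1)] by auto
  have fixed: "\<psi> k x = x" "\<psi> l x = x"
    using S_psi[of k x] S_psi[of l x] assms S by auto
  have "0 \<le> x" "x \<le> 1"
    using S_subset S by auto
  hence "0 < \<psi> k x" "\<psi> k x < 1"
    using assms D_less[of l] by (auto intro!: psi_pos psi_less_1)
  hence "0 < x" "x < 1"
    using fixed(1) by simp_all
  hence "\<psi> k x \<noteq> \<psi> l x"
    by (rule psi_neq[OF assms])
  thus False
    using fixed by simp
qed

lemma S_close_point:
  assumes kl: "k \<in> D" "l \<in> D" "k < l" and "x \<in> S"
  shows "\<exists>y\<in>S. y \<noteq> x \<and> \<bar>y - x\<bar> \<le> (1 - p 0) ^ n"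
  using \<open>x \<in> S\<close>
proof (induction n arbitrary: x)
  case 0
  obtain y where "y \<in> S" "y \<noteq> x"
    using S_other_point[OF kl] by blast
  moreover have "x \<in> {0..1}" "y \<in> {0..1}"
    using S_subset 0 \<open>y \<in> S\<close> by blast+
  hence "\<bar>y - x\<bar> \<le> 1" by auto
  ultimately show ?case by auto
next
  case (Suc n)
  obtain m x' where m: "m \<in> D" "x' \<in> S" "x = \<psi> m x'"
    using Suc.prems by (rule S_cases)
  obtain y' where y': "y' \<in> S" "y' \<noteq> x'" "\<bar>y' - x'\<bar> \<le> (1 - p 0) ^ n"
    using Suc.IH[OF m(2)] by blast
  have "\<bar>\<psi> m y' - \<psi> m x'\<bar> \<le> (1 - p 0) * \<bar>y' - x'\<bar>"
    by (rule psi_contract[OF m(1)])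
  also have "\<dots> \<le> (1 - p 0) * (1 - p 0) ^ n"
    by (intro mult_left_mono y'(3) contraction_nonneg)
  finally show ?case
    using S_psi[OF m(1) y'(1)] psi_inj[OF m(1), of y' x'] y'(2) m(3)
    by (intro bexI[of _ "\<psi> m y'"]) auto
qed

lemma perfect_S:
  assumes kl: "k \<in> D" "l \<in> D" "k < l"
  shows "perfect_set S"
proof -
  have "\<not> x isolated_in S" for x
  proof
    assume "x isolated_in S"
    then obtain T where T: "x \<in> S" "open T" "T \<inter> S = {x}"
      by (auto simp: isolated_in_def)
    then obtain e where e: "e > 0" "\<And>y. dist y x < e \<Longrightarrow> y \<in> T"
      by (metis Int_iff insertI1 open_dist)
    obtain n where n: "(1 - p 0) ^ n < e"
      using real_arch_pow_inv[OF e(1), of "1 - p 0"] p0_pos by auto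
    obtain y where "y \<in> S" "y \<noteq> x" "\<bar>y - x\<bar> \<le> (1 - p 0) ^ n"
      using S_close_point[OF kl T(1)] by blast
    thus False
      using e(2)[of y] n T(3) by (auto simp: dist_real_def)
  qed
  thus ?thesis
    using closed_S by (simp add: perfect_set_def)
qed

end

theorem theorem3:
  fixes s u :: nat and p :: "nat \<Rightarrow> real"
  assumes "s > 2"
    and "\<And>i. i < s \<Longrightarrow> p i > 0"
    and "(\<Sum>i<s. p i) = 1"
    and "u < s"
  shows "S_set s p u \<subseteq> {0..1} \<and>
    closed (S_set s p u) \<and>
    (\<not> (s = 3 \<and> u \<noteq> 0) \<longrightarrow> perfect_set (S_set s p u)) \<and>
    nowhere_dense (S_set s p u) \<and>
    S_set s p u \<in> null_sets lebesgue"
proof -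
  interpret digit_weights s u p
    by unfold_locales (use assms in auto)
  have "perfect_set S" if "\<not> (s = 3 \<and> u \<noteq> 0)"
  proof -
    have "\<exists>k l. k \<in> D \<and> l \<in> D \<and> k < l"
    proof (cases "u = 0 \<or> u \<ge> 3")
      case True
      hence "1 \<in> D" "2 \<in> D"
        using assms(1) by (auto simp: D_def)
      thus ?thesis by (intro exI[of _ 1] exI[of _ 2]) simp
    next
      case False
      \<comment> \<open>Here \<open>u\<close> is \<open>1\<close> or \<open>2\<close> and \<open>s \<ge> 4\<close>, so \<open>3\<close> and the other element of \<open>{1, 2}\<close> are admissible.\<close>
      hence "3 - u \<in> D" "3 \<in> D"
        using assms(1) that unfolding D_def by (auto, presburger+)
      thus ?thesis using False by (intro exI[of _ "3 - u"] exI[of _ 3]) simp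
    qed
    thus ?thesis using perfect_S by blast
  qed
  thus ?thesis
    using S_subset closed_S nowhere_dense_S null_S by (simp add: S_set_eq)
qed

end
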